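(* Let $\mathbb{H}=\{(z_1,z_2)\in\mathbb{C}^2:|z_1|<|z_2|<1\}$ be the Hartogs triangle. Then $A^2(\mathbb{H})$ is not dense in $A^{5/3}(\mathbb{H})$.
   Context: $A^p(\mathbb{H})$ is the Bergman space of holomorphic functions on $\mathbb{H}$ lying in $L^p(\mathbb{H})$ (Lebesgue measure), with the $L^p$ norm. Since $\mathbb{H}$ is bounded, $A^2(\mathbb{H})\subset A^{5/3}(\mathbb{H})$; density is with respect to the $L^{5/3}$ norm. *)

theory Defs
  imports "HOL-Analysis.Analysis"
begin

definition hartogs_triangle :: "(complex \<times> complex) set" where
  "hartogs_triangle = {(z1, z2). cmod z1 < cmod z2 \<and> cmod z2 < 1}"

text \<open>The derivative is required to be complex-linear, i.e. of the form
  \<open>(h1, h2) \<mapsto> a * h1 + b * h2\<close>; \<open>has_derivative\<close> alone only gives a real-linear map.\<close>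

definition holomorphic2_on :: "(complex \<times> complex \<Rightarrow> complex) \<Rightarrow> (complex \<times> complex) set \<Rightarrow> bool" where
  "holomorphic2_on f U \<longleftrightarrow>
     (\<forall>z\<in>U. \<exists>a b. (f has_derivative (\<lambda>h. a * fst h + b * snd h)) (at z within U))"

text \<open>Functions are total on the ambient space, but both the membership condition and the norm only
  see their values on \<open>U\<close>. Holomorphic functions are continuous, so on an open set it makes no
  difference whether \<open>lborel\<close> or its completion is used.\<close>

definition bergman_space :: "real \<Rightarrow> (complex \<times> complex) set \<Rightarrow> (complex \<times> complex \<Rightarrow> complex) set" where
  "bergman_space p U =
     {f. holomorphic2_on f U \<and> set_integrable lborel U (\<lambda>z. cmod (f z) powr p)}"

definition bergman_norm :: "real \<Rightarrow> (complex \<times> complex) set \<Rightarrow> (complex \<times> complex \<Rightarrow> complex) \<Rightarrow> real" where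
  "bergman_norm p U f = (LINT z:U|lborel. cmod (f z) powr p) powr (1 / p)"

definition dense_in_bergman ::
    "(complex \<times> complex \<Rightarrow> complex) set \<Rightarrow> real \<Rightarrow> (complex \<times> complex) set \<Rightarrow> bool" where
  "dense_in_bergman A p U \<longleftrightarrow>
     (\<forall>f\<in>bergman_space p U. \<forall>\<epsilon>>0. \<exists>g\<in>A. bergman_norm p U (\<lambda>z. f z - g z) < \<epsilon>)"

lemma open_hartogs_triangle: "open hartogs_triangle"
proof -
  have "hartogs_triangle = {z. cmod (fst z) < cmod (snd z)} \<inter> {z. cmod (snd z) < 1}"
    by (auto simp: hartogs_triangle_def)
  moreover have "open {z :: complex \<times> complex. cmod (fst z) < cmod (snd z)}"
    by (intro open_Collect_less continuous_intros)
  moreover have "open {z :: complex \<times> complex. cmod (snd z) < 1}"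
    by (intro open_Collect_less continuous_intros)
  ultimately show ?thesis using open_Int by metis
qed

lemma bounded_hartogs_triangle: "bounded hartogs_triangle"
proof -
  have "hartogs_triangle \<subseteq> ball 0 1 \<times> ball 0 1"
    by (auto simp: hartogs_triangle_def)
  thus ?thesis by (rule bounded_subset[rotated]) (intro bounded_Times bounded_ball)
qed

lemma holomorphic2_on_imp_continuous_on: "holomorphic2_on f U \<Longrightarrow> continuous_on U f"
  unfolding holomorphic2_on_def continuous_on_eq_continuous_within
  using has_derivative_continuous by blast

lemma holomorphic2_on_diff:
  assumes "holomorphic2_on f U" "holomorphic2_on g U"
  shows "holomorphic2_on (\<lambda>z. f z - g z) U"
  unfolding holomorphic2_on_def
proof
  fix z assume "z \<in> U"
  then obtain a b c d where
    "(f has_derivative (\<lambda>h. a * fst h + b * snd h)) (at z within U)"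
    "(g has_derivative (\<lambda>h. c * fst h + d * snd h)) (at z within U)"
    using assms unfolding holomorphic2_on_def by meson
  hence "((\<lambda>z. f z - g z) has_derivative
          (\<lambda>h. (a * fst h + b * snd h) - (c * fst h + d * snd h))) (at z within U)"
    by (rule has_derivative_diff)
  also have "(\<lambda>h. (a * fst h + b * snd h) - (c * fst h + d * snd h)) =
             (\<lambda>h. (a - c) * fst h + (b - d) * snd h)"
    by (auto simp: algebra_simps)
  finally show "\<exists>a b. ((\<lambda>z. f z - g z) has_derivative (\<lambda>h. a * fst h + b * snd h)) (at z within U)"
    by blast
qed

lemma set_borel_measurable_cmod_powr:
  assumes "holomorphic2_on f U" "open U" "p > 0"
  shows "set_borel_measurable lborel U (\<lambda>z. cmod (f z) powr p)"
proof -
  have "continuous_on U (\<lambda>z. cmod (f z) powr p)"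
    using holomorphic2_on_imp_continuous_on[OF assms(1)] assms(3)
    by (intro continuous_on_powr' continuous_intros) auto
  hence "(\<lambda>z. indicator U z *\<^sub>R (cmod (f z) powr p)) \<in> borel_measurable borel"
    using assms(2) by (intro borel_measurable_continuous_on_indicator) auto
  thus ?thesis by (simp add: set_borel_measurable_def)
qed

text \<open>The next two lemmas show that \<open>dense_in_bergman\<close> never takes the norm of a function that is
  not in the Bergman space, so the default value of the Bochner integral plays no role.\<close>

lemma bergman_space_mono:
  assumes "open U" "bounded U" "0 < p" "p \<le> q"
  shows "bergman_space q U \<subseteq> bergman_space p U"
proof
  fix f assume "f \<in> bergman_space q U"
  hence f: "holomorphic2_on f U" "set_integrable lborel U (\<lambda>z. cmod (f z) powr q)"
    by (auto simp: bergman_space_def)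
  have U: "U \<in> sets lborel" using assms(1) by simp
  have "emeasure lborel U < \<infinity>" using assms(2) by (rule emeasure_bounded_finite)
  hence "set_integrable lborel U (\<lambda>_. 1 :: real)"
    using U by (simp add: set_integrable_def)
  hence "set_integrable lborel U (\<lambda>z. 1 + cmod (f z) powr q)"
    using f(2) by (rule set_integral_add)
  moreover have "cmod (f z) powr p \<le> 1 + cmod (f z) powr q" for z
  proof (cases "cmod (f z) \<le> 1")
    case True
    hence "cmod (f z) powr p \<le> 1" using assms(3) by (intro powr_le1) auto
    thus ?thesis by (smt (verit) powr_ge_zero)
  next
    case False
    hence "cmod (f z) powr p \<le> cmod (f z) powr q" using assms(4) by (intro powr_mono) auto
    thus ?thesis by simp
  qed
  ultimately have "set_integrable lborel U (\<lambda>z. cmod (f z) powr p)"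
    by (intro set_integrable_bound[OF _ set_borel_measurable_cmod_powr])
       (use assms f(1) in \<open>auto simp: abs_of_nonneg add_nonneg_nonneg\<close>)
  thus "f \<in> bergman_space p U" using f(1) by (simp add: bergman_space_def)
qed

lemma bergman_space_diff:
  assumes "open U" "p > 0" "f \<in> bergman_space p U" "g \<in> bergman_space p U"
  shows "(\<lambda>z. f z - g z) \<in> bergman_space p U"
proof -
  have fg: "holomorphic2_on f U" "set_integrable lborel U (\<lambda>z. cmod (f z) powr p)"
           "holomorphic2_on g U" "set_integrable lborel U (\<lambda>z. cmod (g z) powr p)"
    using assms by (auto simp: bergman_space_def)
  have hol: "holomorphic2_on (\<lambda>z. f z - g z) U"
    using fg by (intro holomorphic2_on_diff)
  have int: "set_integrable lborel U (\<lambda>z. 2 powr p * (cmod (f z) powr p + cmod (g z) powr p))"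
    using fg by (intro set_integrable_mult_right set_integral_add) auto
  have le: "cmod (f z - g z) powr p \<le> 2 powr p * (cmod (f z) powr p + cmod (g z) powr p)" for z
  proof -
    let ?m = "max (cmod (f z)) (cmod (g z))"
    have "cmod (f z - g z) \<le> 2 * ?m"
      using norm_triangle_ineq4[of "f z" "g z"] by linarith
    hence "cmod (f z - g z) powr p \<le> (2 * ?m) powr p"
      using assms(2) by (intro powr_mono2) auto
    also have "\<dots> = 2 powr p * ?m powr p" by (rule powr_mult)
    also have "?m powr p \<le> cmod (f z) powr p + cmod (g z) powr p"
      by (auto simp: max_def)
    finally show ?thesis by simp
  qed
  have "norm (cmod (f z - g z) powr p) \<le> norm (2 powr p * (cmod (f z) powr p + cmod (g z) powr p))" for z
    using order.trans[OF le[of z] abs_ge_self] by simp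
  hence "set_integrable lborel U (\<lambda>z. cmod (f z - g z) powr p)"
    by (intro set_integrable_bound[OF int set_borel_measurable_cmod_powr] AE_I2 impI)
       (use assms hol in auto)
  thus ?thesis using hol by (simp add: bergman_space_def)
qed

end

theory Submission
  imports Defs "HOL-Complex_Analysis.Complex_Residues"
begin

text \<open>
  Averaging a function over the rotations \<open>z \<mapsto> (e z1, e z2)\<close>, \<open>cmod e = 1\<close>, with weight \<open>e\<^sup>2\<close>
  (\<open>circle_avg\<close> below) projects it onto its component that is homogeneous of degree \<open>-2\<close>, and by Jensen's inequality and rotation
  invariance of Lebesgue measure this does not increase any \<open>L\<^sup>p\<close> norm. The function \<open>1 / z2\<^sup>2\<close>, which
  lies in the Bergman space for \<open>p = 5/3\<close>, is its own projection. On the other hand \<open>-2\<close> is the critical degree for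
  \<open>L\<^sup>2\<close> in real dimension four: the square integral over each dyadic shell of \<open>cmod z2\<close> is the same, so the
  projection of a square-integrable function vanishes. Hence the distance of \<open>1 / z2\<^sup>2\<close> from the
  square-integrable functions is positive.\<close>

section \<open>Orthogonal invariance of Lebesgue measure\<close>

lemma nn_integral_lborel_add:
  fixes h :: "'a::euclidean_space \<Rightarrow> ennreal"
  assumes [measurable]: "h \<in> borel_measurable borel"
  shows "(\<integral>\<^sup>+x. h (x + c) \<partial>lborel) = (\<integral>\<^sup>+x. h x \<partial>lborel)"
proof -
  have "(\<integral>\<^sup>+x. h x \<partial>lborel) = (\<integral>\<^sup>+x. h x \<partial>distr lborel borel ((+) c))"
    by (simp only: lborel_distr_plus)
  also have "\<dots> = (\<integral>\<^sup>+x. h (x + c) \<partial>lborel)"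
    by (subst nn_integral_distr) (auto simp: add.commute)
  finally show ?thesis ..
qed

text \<open>Convolving with the indicator of the unit ball, which is invariant under \<open>T\<close>, reduces the
  claim to translation invariance and Tonelli's theorem.\<close>

lemma nn_integral_lborel_orthogonal:
  fixes T :: "'a::euclidean_space \<Rightarrow> 'a" and h :: "'a \<Rightarrow> ennreal"
  assumes T: "orthogonal_transformation T" and h[measurable]: "h \<in> borel_measurable borel"
  shows "(\<integral>\<^sup>+x. h (T x) \<partial>lborel) = (\<integral>\<^sup>+x. h x \<partial>lborel)"
proof -
  have lin: "linear T" and nT: "\<And>x. norm (T x) = norm x"
    using T by (auto simp: orthogonal_transformation)
  have "inj T"
    using lin nT by (metis linear_injective_0 norm_eq_zero)
  then have "surj T"
    using lin by (simp add: linear_injective_imp_surjective)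
  then obtain S where S: "\<And>x. T (S x) = x"
    by (metis surj_f_inv_f)
  have cT: "continuous_on A T" for A
    using lin by (intro linear_continuous_on) (simp add: linear_conv_bounded_linear)
  then have [measurable]: "T \<in> borel_measurable borel"
    by (intro borel_measurable_continuous_onI)
  have b: "indicator (ball 0 1) \<in> borel_measurable (borel :: 'a measure)"
    by (intro borel_measurable_indicator) simp
  have plus: "(\<lambda>x. fst x + T (snd x)) \<in> borel_measurable (lborel \<Otimes>\<^sub>M lborel)"
    and minus: "(\<lambda>x. snd x - T (fst x)) \<in> borel_measurable (lborel \<Otimes>\<^sub>M lborel)"
    by (simp_all only: lborel_prod measurable_lborel1 measurable_lborel2)
       (intro borel_measurable_continuous_onI continuous_intros continuous_on_compose2 [OF cT [of UNIV]] subset_UNIV)+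
  define m where "m = emeasure lborel (ball (0::'a) 1)"
  have m: "m \<noteq> 0" "m \<noteq> \<infinity>"
    using less_imp_neq [OF unit_ball_vol_pos [of "real DIM('a)"]] by (simp_all add: m_def emeasure_ball)
  \<comment> \<open>Since \<open>x = T (S x)\<close> and \<open>T\<close> preserves norms, the
    integrand is the indicator of the unit ball about \<open>S x\<close>, whose volume is the same
    for every \<open>x\<close>.\<close>
  have ball: "(\<integral>\<^sup>+y. indicator (ball 0 1) (x - T y) \<partial>lborel) = m" for x
  proof -
    have "x - T y = T (S x - y)" for y
      using lin S by (simp add: linear_diff)
    then have "norm (x - T y) = dist (S x) y" for y
      by (simp add: nT dist_norm)
    then have "(\<integral>\<^sup>+y. indicator (ball 0 1) (x - T y) \<partial>lborel) = (\<integral>\<^sup>+y. indicator (ball (S x) 1) y \<partial>lborel)"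
      by (intro nn_integral_cong) (auto simp: indicator_def)
    also have "\<dots> = m"
      by (simp add: m_def emeasure_ball)
    finally show ?thesis .
  qed
  \<comment> \<open>The double integral of \<open>indicator (ball 0 1) x * h (x + T y)\<close> is
    evaluated in two ways. Integrating over \<open>y\<close> first, the summand \<open>x\<close> is
    absorbed as a translation by \<open>S x\<close>; integrating over \<open>x\<close> first, a
    shift by \<open>T y\<close> moves the dependence on \<open>y\<close> into the ball indicator,
    which then integrates to \<open>m\<close>. As \<open>m\<close> is neither zero nor infinite, it
    cancels.\<close>
  have "m * (\<integral>\<^sup>+y. h (T y) \<partial>lborel) = (\<integral>\<^sup>+x. indicator (ball 0 1) x * (\<integral>\<^sup>+y. h (T y) \<partial>lborel) \<partial>(lborel :: 'a measure))"
    by (subst nn_integral_multc) (auto simp: m_def intro: borel_measurable_indicator)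
  also have "\<dots> = (\<integral>\<^sup>+x. indicator (ball 0 1) x * (\<integral>\<^sup>+y. h (x + T y) \<partial>lborel) \<partial>lborel)"
  proof (intro nn_integral_cong)
    fix x
    have "(\<integral>\<^sup>+y. h (T y) \<partial>lborel) = (\<integral>\<^sup>+y. h (T (y + S x)) \<partial>lborel)"
      by (rule nn_integral_lborel_add [symmetric]) measurable
    also have "\<dots> = (\<integral>\<^sup>+y. h (x + T y) \<partial>lborel)"
      using lin S by (simp add: linear_add add.commute)
    finally show "indicator (ball 0 1) x * (\<integral>\<^sup>+y. h (T y) \<partial>lborel) = indicator (ball 0 1) x * (\<integral>\<^sup>+y. h (x + T y) \<partial>lborel)"
      by simp
  qed
  also have "\<dots> = (\<integral>\<^sup>+x. \<integral>\<^sup>+y. indicator (ball 0 1) x * h (x + T y) \<partial>lborel \<partial>lborel)"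
    by (subst nn_integral_cmult) auto
  also have "\<dots> = (\<integral>\<^sup>+y. \<integral>\<^sup>+x. indicator (ball 0 1) x * h (x + T y) \<partial>lborel \<partial>lborel)"
    using measurable_compose [OF plus h]
    by (intro lborel_pair.Fubini' [symmetric]) (auto simp: case_prod_beta' intro!: borel_measurable_times_ennreal measurable_compose [OF _ b])
  also have "\<dots> = (\<integral>\<^sup>+y. \<integral>\<^sup>+x. indicator (ball 0 1) (x - T y) * h x \<partial>lborel \<partial>lborel)"
  proof (rule nn_integral_cong)
    fix y
    have "(\<lambda>x. indicator (ball 0 1) (x - T y) * h x) \<in> borel_measurable borel"
      by (intro borel_measurable_times_ennreal measurable_compose [OF _ b] h) simp
    then show "(\<integral>\<^sup>+x. indicator (ball 0 1) x * h (x + T y) \<partial>lborel) = (\<integral>\<^sup>+x. indicator (ball 0 1) (x - T y) * h x \<partial>lborel)"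
      using nn_integral_lborel_add [of "\<lambda>x. indicator (ball 0 1) (x - T y) * h x" "T y"] by simp
  qed
  also have "\<dots> = (\<integral>\<^sup>+x. \<integral>\<^sup>+y. indicator (ball 0 1) (x - T y) * h x \<partial>lborel \<partial>lborel)"
    using measurable_compose [OF minus b] by (intro lborel_pair.Fubini') (auto simp: case_prod_beta' intro!: borel_measurable_times_ennreal measurable_compose [OF _ b])
  also have "\<dots> = (\<integral>\<^sup>+x. m * h x \<partial>lborel)"
    by (subst nn_integral_multc) (auto simp: ball intro!: measurable_compose [OF _ b])
  also have "\<dots> = m * (\<integral>\<^sup>+x. h x \<partial>lborel)"
    by (rule nn_integral_cmult) auto
  finally show ?thesis
    using m by (auto simp: ennreal_mult_cancel_left)
qed

section \<open>Averages over circles\<close>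

text \<open>Convexity of the power function, with the tangent taken at \<open>m\<close>. Young's
  inequality for \<open>x\<close> and \<open>m powr (p - 1)\<close> with conjugate exponents
  \<open>p\<close> and \<open>q\<close> gives it without differentiation.\<close>

lemma powr_ge_tangent:
  fixes m x p :: real
  assumes "0 \<le> m" "0 \<le> x" "1 < p"
  shows "m powr p + p * m powr (p - 1) * (x - m) \<le> x powr p"
proof -
  define q where "q = p / (p - 1)"
  have pq: "q > 1" "1 / p + 1 / q = 1" "(p - 1) * q = p"
    using assms by (auto simp: q_def field_simps)
  have "x * m powr (p - 1) \<le> x powr p / p + (m powr (p - 1)) powr q / q"
    using assms pq by (intro Youngs_inequality) auto
  also have "\<dots> = x powr p / p + m powr p / q"
    by (simp add: powr_powr pq)
  also have "1 / q = (p - 1) / p"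
    by (simp add: q_def)
  then have "m powr p / q = m powr p * (p - 1) / p"
    by (metis times_divide_eq_right mult.right_neutral)
  finally have "p * (x * m powr (p - 1)) \<le> x powr p + m powr p * (p - 1)"
    using assms by (simp add: field_simps)
  \<comment> \<open>The case \<open>m = 0\<close> rests on \<open>0 powr a = 0\<close>; otherwise
    this is the exponent law.\<close>
  moreover have "m powr (p - 1) * m = m powr p"
    using assms by (cases "m = 0") (simp_all add: powr_diff)
  moreover have "p * m powr (p - 1) * (x - m) = p * (x * m powr (p - 1)) - p * (m powr (p - 1) * m)"
    by (simp add: algebra_simps)
  ultimately show ?thesis
    by (simp add: algebra_simps)
qed

text \<open>Jensen's inequality on an interval of length one: integrate the tangent inequality at
  the mean \<open>m\<close>, where the linear term has integral zero.\<close>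

lemma integral_powr_le:
  fixes k :: "real \<Rightarrow> real"
  assumes k: "continuous_on {0..1} k" "\<And>t. t \<in> {0..1} \<Longrightarrow> 0 \<le> k t" and p: "1 < p"
  shows "integral {0..1} k powr p \<le> integral {0..1} (\<lambda>t. k t powr p)"
proof -
  define m where "m = integral {0..1} k"
  have m: "0 \<le> m"
    unfolding m_def using k by (intro integral_nonneg integrable_continuous_real) auto
  have "(k has_integral m) {0..1}"
    using k unfolding m_def by (intro integrable_integral integrable_continuous_real)
  then have 1: "((\<lambda>t. m powr p + p * m powr (p - 1) * (k t - m)) has_integral
      (m powr p * (1 - 0) + p * m powr (p - 1) * (m - m * (1 - 0)))) {0..1}"
    using has_integral_const_real [of "m powr p" 0 1] has_integral_const_real [of m 0 1]
    by (intro has_integral_add has_integral_mult_right has_integral_diff) (simp_all add: mult.commute)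
  have 2: "((\<lambda>t. k t powr p) has_integral integral {0..1} (\<lambda>t. k t powr p)) {0..1}"
    using k p by (intro integrable_integral integrable_continuous_real continuous_on_powr') auto
  show ?thesis
    using has_integral_le [OF 1 2] powr_ge_tangent [OF m k(2) p] by (simp add: m_def)
qed

text \<open>This is the Fourier coefficient of index -2 of the function that \<open>g\<close>
  induces on the circle orbit of \<open>z\<close>; the weight cancels the factor that a function
  homogeneous of degree -2 acquires under rotation.\<close>

definition circle_avg :: "(complex \<times> complex \<Rightarrow> complex) \<Rightarrow> complex \<times> complex \<Rightarrow> complex" where
  "circle_avg g z = integral {0..1} (\<lambda>t. cis (2 * pi * t) ^ 2 * g (cis (2 * pi * t) * fst z, cis (2 * pi * t) * snd z))"

lemma orthogonal_transformation_unit_mult: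
  assumes "cmod a = 1"
  shows "orthogonal_transformation (\<lambda>z::complex \<times> complex. (a * fst z, a * snd z))"
  unfolding orthogonal_transformation
proof
  show "linear (\<lambda>z::complex \<times> complex. (a * fst z, a * snd z))"
    by (rule linearI) (auto simp: algebra_simps)
  show "\<forall>v. norm (a * fst v, a * snd v) = norm v"
    using assms by (auto simp: norm_prod_def norm_mult)
qed

lemma continuous_on_circle_avg_integrand:
  assumes "continuous_on U g" "\<And>a. cmod a = 1 \<Longrightarrow> (a * fst z, a * snd z) \<in> U"
  shows "continuous_on {0..1} (\<lambda>t. cis (2 * pi * t) ^ 2 * g (cis (2 * pi * t) * fst z, cis (2 * pi * t) * snd z))"
  using assms by (intro continuous_intros continuous_on_compose2 [OF assms(1)]) auto

lemma nn_integral_circle_avg_le: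
  assumes U: "open U" "\<And>a z. cmod a = 1 \<Longrightarrow> z \<in> U \<Longrightarrow> (a * fst z, a * snd z) \<in> U"
    and g: "continuous_on U g" and p: "1 < p"
  shows "(\<integral>\<^sup>+z. ennreal (cmod (circle_avg g z) powr p) * indicator U z \<partial>lborel) \<le> (\<integral>\<^sup>+z. ennreal (cmod (g z) powr p) * indicator U z \<partial>lborel)"
proof -
  \<comment> \<open>The cut-off by the indicator gives a Borel function on the whole space, as
    \<open>g\<close> is only known to be continuous on \<open>U\<close>.\<close>
  define G where "G z = ennreal (indicator U z *\<^sub>R cmod (g z) powr p)" for z
  define e where "e t = cis (2 * pi * t)" for t
  have ne: "cmod (e t) = 1" for t
    by (simp add: e_def)
  have ce[continuous_intros]: "continuous_on S e" for S
    unfolding e_def by (intro continuous_intros)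
  have rot: "(\<lambda>x. (e (fst x) * fst (snd x), e (fst x) * snd (snd x)))
      \<in> borel_measurable (lborel \<Otimes>\<^sub>M (lborel :: (complex \<times> complex) measure))"
    by (simp only: lborel_prod measurable_lborel1 measurable_lborel2, intro borel_measurable_continuous_onI continuous_intros continuous_on_compose2 [OF ce]) auto
  have "continuous_on U (\<lambda>z. cmod (g z) powr p)"
    using g p by (intro continuous_on_powr' continuous_intros) auto
  then have "(\<lambda>z. indicator U z *\<^sub>R cmod (g z) powr p) \<in> borel_measurable borel"
    using U(1) by (intro borel_measurable_continuous_on_indicator) auto
  then have G[measurable]: "G \<in> borel_measurable borel"
    unfolding G_def by measurable
  \<comment> \<open>Pointwise Jensen on each orbit. The weight has modulus one and the orbit of a
    point of \<open>U\<close> stays in \<open>U\<close>, so only \<open>G\<close> along the orbit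
    remains.\<close>
  have "(\<integral>\<^sup>+z. ennreal (cmod (circle_avg g z) powr p) * indicator U z \<partial>lborel)
      \<le> (\<integral>\<^sup>+z. \<integral>\<^sup>+t. G (e t * fst z, e t * snd z) * indicator {0..1} t \<partial>lborel \<partial>lborel)"
  proof (intro nn_integral_mono)
    fix z :: "complex \<times> complex"
    show "ennreal (cmod (circle_avg g z) powr p) * indicator U z \<le> (\<integral>\<^sup>+t. G (e t * fst z, e t * snd z) * indicator {0..1} t \<partial>lborel)"
    proof (cases "z \<in> U")
      case True
      define k where "k t = e t ^ 2 * g (e t * fst z, e t * snd z)" for t
      have ck: "continuous_on {0..1} k"
        unfolding k_def e_def using True U by (intro continuous_on_circle_avg_integrand [OF g]) auto
      have "cmod (circle_avg g z) \<le> integral {0..1} (\<lambda>t. cmod (k t))"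
        unfolding circle_avg_def e_def [symmetric] k_def [symmetric] using ck
        by (intro integral_norm_bound_integral integrable_continuous_real continuous_intros) auto
      then have "cmod (circle_avg g z) powr p \<le> integral {0..1} (\<lambda>t. cmod (k t)) powr p"
        using p by (intro powr_mono2) auto
      also have "\<dots> \<le> integral {0..1} (\<lambda>t. cmod (k t) powr p)"
        using p ck by (intro integral_powr_le continuous_intros) auto
      finally have "ennreal (cmod (circle_avg g z) powr p) \<le> ennreal (integral {0..1} (\<lambda>t. cmod (k t) powr p))"
        by (rule ennreal_leI)
      also have "\<dots> = (\<integral>\<^sup>+t. ennreal (cmod (k t) powr p) * indicator {0..1} t \<partial>lborel)"
        using p ck by (intro nn_integral_has_integral_lebesgue' [symmetric] integrable_integral
          integrable_continuous_real continuous_on_powr' continuous_intros) auto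
      also have "\<dots> = (\<integral>\<^sup>+t. G (e t * fst z, e t * snd z) * indicator {0..1} t \<partial>lborel)"
        using U(2) [OF ne True] by (auto simp: G_def k_def norm_mult norm_power ne intro!: nn_integral_cong)
      finally show ?thesis
        using True by simp
    qed auto
  qed
  also have "\<dots> = (\<integral>\<^sup>+t. \<integral>\<^sup>+z. G (e t * fst z, e t * snd z) * indicator {0..1} t \<partial>lborel \<partial>lborel)"
    using measurable_compose [OF rot G] by (intro lborel_pair.Fubini') (auto simp: case_prod_beta)
  \<comment> \<open>For fixed \<open>t\<close> the rotation by \<open>e t\<close> is orthogonal, so
    the inner integral does not depend on \<open>t\<close>.\<close>
  also have "\<dots> = (\<integral>\<^sup>+t. (\<integral>\<^sup>+z. G z \<partial>lborel) * indicator {0..1::real} t \<partial>lborel)"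
  proof (intro nn_integral_cong)
    fix t
    have "(\<lambda>z. G (e t * fst z, e t * snd z)) \<in> borel_measurable borel"
      by (intro measurable_compose [OF _ G] borel_measurable_continuous_onI continuous_intros)
    then show "(\<integral>\<^sup>+z. G (e t * fst z, e t * snd z) * indicator {0..1} t \<partial>lborel) = (\<integral>\<^sup>+z. G z \<partial>lborel) * indicator {0..1} t"
      by (simp add: nn_integral_multc nn_integral_lborel_orthogonal [OF orthogonal_transformation_unit_mult [OF ne] G])
  qed
  also have "\<dots> = (\<integral>\<^sup>+z. G z \<partial>lborel)"
    by (subst nn_integral_cmult_indicator) auto
  also have "\<dots> = (\<integral>\<^sup>+z. ennreal (cmod (g z) powr p) * indicator U z \<partial>lborel)"
    by (intro nn_integral_cong) (auto simp: G_def indicator_def)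
  finally show ?thesis .
qed

text \<open>Serves to make the squared modulus of the average Borel measurable on
  \<open>U\<close>.\<close>

lemma continuous_on_circle_avg:
  assumes g: "continuous_on U g" and U: "\<And>a z. cmod a = 1 \<Longrightarrow> z \<in> U \<Longrightarrow> (a * fst z, a * snd z) \<in> U"
  shows "continuous_on U (circle_avg g)"
proof -
  have "continuous_on U (\<lambda>z. integral (cbox 0 1) (\<lambda>t. cis (2 * pi * t) ^ 2 * g (cis (2 * pi * t) * fst z, cis (2 * pi * t) * snd z)))"
    unfolding circle_avg_def
    by (intro integral_continuous_on_param, unfold case_prod_beta)
       (auto intro!: continuous_intros continuous_on_compose2 [OF g] U)
  then show ?thesis
    by (simp add: circle_avg_def [abs_def])
qed

lemma circle_avg_diff:
  assumes "continuous_on U f" "continuous_on U g" "\<And>a. cmod a = 1 \<Longrightarrow> (a * fst z, a * snd z) \<in> U"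
  shows "circle_avg (\<lambda>z. f z - g z) z = circle_avg f z - circle_avg g z"
  unfolding circle_avg_def right_diff_distrib
  by (intro integral_diff integrable_continuous_real continuous_on_circle_avg_integrand [OF assms(1)]
      continuous_on_circle_avg_integrand [OF assms(2)] assms(3))

lemma circle_avg_inverse_square:
  "circle_avg (\<lambda>z. 1 / snd z ^ 2) z = 1 / snd z ^ 2"
proof -
  have "cis (2 * pi * t) ^ 2 * (1 / (cis (2 * pi * t) * snd z) ^ 2) = 1 / snd z ^ 2" for t
    by (simp add: power_mult_distrib)
  then show ?thesis
    by (simp add: circle_avg_def)
qed

section \<open>Homogeneity on the Hartogs triangle\<close>

lemma hartogs_triangle_mult:
  assumes "z \<in> hartogs_triangle" "w \<noteq> 0" "cmod w * cmod (snd z) < 1"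
  shows "(w * fst z, w * snd z) \<in> hartogs_triangle"
  using assms by (auto simp: hartogs_triangle_def norm_mult)

lemma hartogs_triangle_rotate:
  assumes "cmod a = 1" "z \<in> hartogs_triangle"
  shows "(a * fst z, a * snd z) \<in> hartogs_triangle"
  using assms by (intro hartogs_triangle_mult) (auto simp: hartogs_triangle_def)

text \<open>Substituting \<open>w = r * cis (2 * pi * t)\<close>, so that dw = 2 pi i w dt, turns
  the left side into the contour integral of \<open>w * g (w * fst z, w * snd z)\<close> over the
  circle of radius \<open>r\<close>, divided by 2 pi i. The residue is the same for all
  \<open>r\<close>, which expresses homogeneity of degree -2 along the ray.\<close>

lemma circle_avg_eq_residue:
  assumes g: "holomorphic2_on g hartogs_triangle" and z: "z \<in> hartogs_triangle" and r: "0 < r" "r \<le> 1"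
  shows "of_real r ^ 2 * circle_avg g (r *\<^sub>R z) = residue (\<lambda>w. w * g (w * fst z, w * snd z)) 0"
proof -
  define \<phi> where "\<phi> w = w * g (w * fst z, w * snd z)" for w
  have z2: "0 < cmod (snd z)" "cmod (snd z) < 1"
    using z by (auto simp: hartogs_triangle_def intro: le_less_trans)
  \<comment> \<open>The slice through \<open>z\<close> stays in the triangle exactly while
    \<open>w\<close> is nonzero and \<open>cmod w * cmod (snd z) < 1\<close>. Since
    \<open>cmod (snd z) < 1\<close>, this punctured disc contains every circle of radius at most one
    about 0.\<close>
  define s where "s = ball (0::complex) (1 / cmod (snd z))"
  have "\<phi> holomorphic_on s - {0}"
    unfolding \<phi>_def
  proof (intro holomorphic_intros)
    show "(\<lambda>w. g (w * fst z, w * snd z)) holomorphic_on s - {0}"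
      unfolding holomorphic_on_def
    proof
      fix w assume w: "w \<in> s - {0}"
      then have "cmod w * cmod (snd z) < 1"
        using z2 by (simp add: s_def pos_less_divide_eq)
      then have "(w * fst z, w * snd z) \<in> hartogs_triangle"
        using w z by (intro hartogs_triangle_mult) auto
      note wz = this
      obtain a b where "(g has_derivative (\<lambda>h. a * fst h + b * snd h)) (at (w * fst z, w * snd z) within hartogs_triangle)"
        using bspec [OF g [unfolded holomorphic2_on_def] wz] by (elim exE)
      then have ab: "(g has_derivative (\<lambda>h. a * fst h + b * snd h)) (at (w * fst z, w * snd z))"
        by (simp only: at_within_open [OF wz open_hartogs_triangle])
      have "((\<lambda>w. (w * fst z, w * snd z)) has_derivative (\<lambda>h. (h * fst z, h * snd z))) (at w)"
        by (auto intro!: derivative_eq_intros)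
      \<comment> \<open>Complex linearity of the derivative of \<open>g\<close> makes the composed
        derivative multiplication by the single number \<open>a * fst z + b * snd z\<close>, that
        is, complex differentiability in \<open>w\<close>.\<close>
      from has_derivative_compose [OF this ab]
      have "((\<lambda>w. g (w * fst z, w * snd z)) has_derivative (\<lambda>h. (a * fst z + b * snd z) * h)) (at w)"
        by (simp add: algebra_simps)
      then show "(\<lambda>w. g (w * fst z, w * snd z)) field_differentiable at w within s - {0}"
        using field_differentiable_at_within field_differentiable_def has_field_derivative_def by blast
    qed
  qed
  moreover have "1 < 1 / cmod (snd z)"
    using z2 by simp
  then have "cball 0 r \<subseteq> s"
    using r by (auto simp: s_def)
  ultimately have "(\<phi> has_contour_integral 2 * pi * \<i> * residue \<phi> 0) (circlepath 0 r)"
    using r z2 by (intro base_residue [of s]) (auto simp: s_def)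
  then have "((\<lambda>t. \<phi> (r * cis (2 * pi * t)) * (2 * pi * \<i> * r * cis (2 * pi * t))) has_integral
      2 * pi * \<i> * residue \<phi> 0) {0..1}"
    unfolding has_contour_integral_def
  proof (rule has_integral_eq [rotated])
    fix t :: real assume "t \<in> {0..1}"
    then have "vector_derivative (circlepath 0 r) (at t within {0..1}) = 2 * pi * \<i> * r * cis (2 * pi * t)"
      by (simp add: vector_derivative_circlepath01 cis_conv_exp mult_ac)
    moreover have "circlepath 0 r t = r * cis (2 * pi * t)"
      by (simp add: circlepath cis_conv_exp mult_ac)
    ultimately show "\<phi> (circlepath 0 r t) * vector_derivative (circlepath 0 r) (at t within {0..1}) =
        \<phi> (r * cis (2 * pi * t)) * (2 * pi * \<i> * r * cis (2 * pi * t))"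
      by (simp only:)
  qed
  then have "((\<lambda>t. (\<phi> (r * cis (2 * pi * t)) * (2 * pi * \<i> * r * cis (2 * pi * t))) / (2 * pi * \<i>)) has_integral
      (2 * pi * \<i> * residue \<phi> 0) / (2 * pi * \<i>)) {0..1}"
    by (rule has_integral_divide)
  also have "(\<lambda>t. (\<phi> (r * cis (2 * pi * t)) * (2 * pi * \<i> * r * cis (2 * pi * t))) / (2 * pi * \<i>)) =
    (\<lambda>t. of_real r ^ 2 * (cis (2 * pi * t) ^ 2 * g (cis (2 * pi * t) * fst (r *\<^sub>R z), cis (2 * pi * t) * snd (r *\<^sub>R z))))"
    by (auto simp: \<phi>_def power2_eq_square scaleR_conv_of_real mult_ac)
  finally show ?thesis
    by (simp add: circle_avg_def \<phi>_def [abs_def] integral_unique flip: integral_mult_right)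
qed

text \<open>The radii 1 and 1/2 yield the same residue; the factor is the quotient of the squared
  radii.\<close>

lemma circle_avg_half:
  assumes "holomorphic2_on g hartogs_triangle" "z \<in> hartogs_triangle"
  shows "circle_avg g ((1 / 2) *\<^sub>R z) = 4 * circle_avg g z"
  using circle_avg_eq_residue [OF assms, of 1] circle_avg_eq_residue [OF assms, of "1 / 2"]
  by (simp add: power2_eq_square)

lemma scaleR_half_in_hartogs_triangle:
  "(1 / 2) *\<^sub>R z \<in> hartogs_triangle \<and> cmod (snd ((1 / 2) *\<^sub>R z)) < 1 / 2 \<longleftrightarrow> z \<in> hartogs_triangle"
  by (cases z) (auto simp: hartogs_triangle_def)

text \<open>Halving maps the triangle onto its part in \<open>V\<close> and leaves the square
  integral of the average unchanged. So the part outside \<open>V\<close> contributes nothing to a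
  finite total.\<close>

lemma circle_avg_eq_0_AE:
  assumes g: "holomorphic2_on g hartogs_triangle"
    and fin: "(\<integral>\<^sup>+z. ennreal (cmod (g z) powr 2) * indicator hartogs_triangle z \<partial>lborel) < \<infinity>"
  shows "AE z in lborel. z \<in> hartogs_triangle \<longrightarrow> 1 / 2 \<le> cmod (snd z) \<longrightarrow> circle_avg g z = 0"
proof -
  let ?H = hartogs_triangle
  define K where "K z = ennreal (indicator ?H z *\<^sub>R cmod (circle_avg g z) powr 2)" for z
  have cg: "continuous_on ?H g"
    using g by (rule holomorphic2_on_imp_continuous_on)
  have "continuous_on ?H (\<lambda>z. cmod (circle_avg g z) powr 2)"
    by (intro continuous_on_powr' continuous_intros continuous_on_circle_avg [OF cg] hartogs_triangle_rotate) auto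
  then have "(\<lambda>z. indicator ?H z *\<^sub>R cmod (circle_avg g z) powr 2) \<in> borel_measurable borel"
    using open_hartogs_triangle by (intro borel_measurable_continuous_on_indicator) auto
  then have K[measurable]: "K \<in> borel_measurable borel"
    unfolding K_def by measurable
  define V where "V = {z::complex \<times> complex. cmod (snd z) < 1 / 2}"
  have "open V"
    unfolding V_def by (intro open_Collect_less continuous_intros)
  then have [measurable]: "V \<in> sets borel"
    by simp
  have "(\<integral>\<^sup>+z. K z \<partial>lborel) = (\<integral>\<^sup>+z. ennreal (cmod (circle_avg g z) powr 2) * indicator ?H z \<partial>lborel)"
    by (intro nn_integral_cong) (auto simp: K_def indicator_def)
  also have "\<dots> \<le> (\<integral>\<^sup>+z. ennreal (cmod (g z) powr 2) * indicator ?H z \<partial>lborel)"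
    by (intro nn_integral_circle_avg_le open_hartogs_triangle hartogs_triangle_rotate cg) auto
  finally have finK: "(\<integral>\<^sup>+z. K z \<partial>lborel) < \<infinity>"
    using fin by simp
  \<comment> \<open>Change of variables under halving: the Jacobian 1/16 of real dimension four
    cancels the factor 16 by which the squared modulus of the average grows.\<close>
  have "(\<integral>\<^sup>+z. K z * indicator V z \<partial>lborel) = (\<integral>\<^sup>+z. K z * indicator V z
      \<partial>density (distr lborel borel (\<lambda>x. 0 + (1 / 2) *\<^sub>R x)) (\<lambda>_. ennreal (\<bar>1 / 2\<bar> ^ DIM(complex \<times> complex))))"
    by (subst lborel_affine [of "1 / 2" 0]) auto
  also have "\<dots> = (\<integral>\<^sup>+z. ennreal (1 / 16) * (K ((1 / 2) *\<^sub>R z) * indicator V ((1 / 2) *\<^sub>R z)) \<partial>lborel)"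
    by (subst nn_integral_density, simp, simp, subst nn_integral_distr) (auto simp: power4_eq_xxxx)
  also have "\<dots> = (\<integral>\<^sup>+z. K z \<partial>lborel)"
  proof (intro nn_integral_cong)
    fix z
    show "ennreal (1 / 16) * (K ((1 / 2) *\<^sub>R z) * indicator V ((1 / 2) *\<^sub>R z)) = K z"
    proof (cases "z \<in> ?H")
      case True
      then have "K ((1 / 2) *\<^sub>R z) = ennreal (16 * cmod (circle_avg g z) powr 2)"
        using scaleR_half_in_hartogs_triangle [of z]
        by (simp add: K_def circle_avg_half [OF g True] norm_mult powr_mult)
      then show ?thesis
        using True scaleR_half_in_hartogs_triangle [of z]
        by (simp add: K_def V_def flip: ennreal_mult)
    next
      case False
      then show ?thesis
        using scaleR_half_in_hartogs_triangle [of z] by (auto simp: K_def V_def indicator_def)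
    qed
  qed
  finally have eq: "(\<integral>\<^sup>+z. K z * indicator V z \<partial>lborel) = (\<integral>\<^sup>+z. K z \<partial>lborel)" .
  have "(\<integral>\<^sup>+z. K z \<partial>lborel) = (\<integral>\<^sup>+z. K z * indicator V z + K z * indicator (- V) z \<partial>lborel)"
    by (intro nn_integral_cong) (auto simp: indicator_def)
  also have "\<dots> = (\<integral>\<^sup>+z. K z \<partial>lborel) + (\<integral>\<^sup>+z. K z * indicator (- V) z \<partial>lborel)"
    by (subst nn_integral_add) (auto simp: eq)
  \<comment> \<open>Square integrability of \<open>g\<close> enters here: cancelling the total from
    both sides requires it to be finite.\<close>
  finally have "(\<integral>\<^sup>+z. K z * indicator (- V) z \<partial>lborel) = 0"
    using finK by (metis add.right_neutral ennreal_add_left_cancel less_irrefl infinity_ennreal_def)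
  then have "AE z in lborel. K z * indicator (- V) z = 0"
    by (subst (asm) nn_integral_0_iff_AE) auto
  then show ?thesis
    by eventually_elim (auto simp: K_def V_def indicator_eq_0_iff)
qed

section \<open>Integrability of the inverse square, by dyadic shells\<close>

lemma inverse_square_in_bergman_space:
  "(\<lambda>z. 1 / snd z ^ 2) \<in> bergman_space (5 / 3) hartogs_triangle"
proof -
  let ?H = hartogs_triangle
  let ?f = "\<lambda>z::complex \<times> complex. 1 / snd z ^ 2"
  have hol: "holomorphic2_on ?f ?H"
    unfolding holomorphic2_on_def
  proof
    fix z :: "complex \<times> complex" assume "z \<in> ?H"
    then have "snd z \<noteq> 0"
      by (auto simp: hartogs_triangle_def)
    then have "(?f has_derivative (\<lambda>h. 0 * fst h + (- 2 / snd z ^ 3) * snd h)) (at z within ?H)"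
      by (auto intro!: derivative_eq_intros simp: field_simps power2_eq_square power3_eq_cube)
    then show "\<exists>a b. (?f has_derivative (\<lambda>h. a * fst h + b * snd h)) (at z within ?H)"
      by blast
  qed
  \<comment> \<open>On the shell where \<open>cmod (snd z)\<close> lies between 2^-(n+1) and 2^-n,
    the integrand is at most \<open>a n\<close>, and the shell lies in \<open>B n\<close> because
    \<open>norm z \<le> cmod (fst z) + cmod (snd z) < 2 * cmod (snd z)\<close>. The volume of
    \<open>B n\<close> decays like 16^-n, which leaves a geometric series of ratio
    \<open>2 powr (10 / 3 - 4)\<close>. The constant \<open>c\<close> collects the unit ball volume,
    the fourth power of the factor 2 in the radius, and \<open>a 0\<close>.\<close>
  define c where "c = unit_ball_vol 4 * 16 * 2 powr (10 / 3)"
  define B where "B n = ball (0 :: complex \<times> complex) (2 * (1 / 2) ^ n)" for n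
  define a :: "nat \<Rightarrow> real" where "a n = 2 powr (10 / 3 * (n + 1))" for n
  have le: "ennreal (cmod (?f z) powr (5 / 3)) * indicator ?H z \<le> (\<Sum>n. ennreal (a n) * indicator (B n) z)" for z
  proof (cases "z \<in> ?H")
    case True
    then have z: "cmod (fst z) < cmod (snd z)" "cmod (snd z) < 1" "0 < cmod (snd z)"
      by (auto simp: hartogs_triangle_def intro: le_less_trans)
    \<comment> \<open>The least such index names the shell of \<open>z\<close>: minimality gives the
      strict upper bound, and for \<open>n = 0\<close> that bound is
      \<open>cmod (snd z) < 1\<close>.\<close>
    define n where "n = (LEAST n. (1 / 2) ^ Suc n \<le> cmod (snd z))"
    have "\<exists>n. (1 / 2) ^ n < cmod (snd z)"
      using z by (intro real_arch_pow_inv) auto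
    then obtain m where "(1 / 2) ^ m < cmod (snd z)" ..
    moreover have "(1 / 2) ^ Suc m \<le> (1 / 2 :: real) ^ m"
      by simp
    ultimately have "(1 / 2) ^ Suc m \<le> cmod (snd z)"
      by linarith
    then have n: "(1 / 2) ^ Suc n \<le> cmod (snd z)"
      unfolding n_def by (rule LeastI)
    have n': "cmod (snd z) < (1 / 2) ^ n"
    proof (cases n)
      case (Suc k)
      then have "\<not> (1 / 2) ^ Suc k \<le> cmod (snd z)"
        unfolding n_def by (intro not_less_Least) auto
      then show ?thesis
        using Suc by simp
    qed (use z in auto)
    have "norm z \<le> cmod (fst z) + cmod (snd z)"
      by (metis norm_Pair_le prod.collapse)
    then have "z \<in> B n"
      using z n' by (auto simp: B_def)
    have "cmod (?f z) = cmod (snd z) powr (- 2)"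
      using z by (simp add: norm_divide norm_power powr_minus inverse_eq_divide)
    then have "cmod (?f z) powr (5 / 3) = cmod (snd z) powr (- (10 / 3))"
      by (simp add: powr_powr)
    also have "\<dots> \<le> ((1 / 2) ^ Suc n) powr (- (10 / 3))"
      using n by (intro powr_mono2') auto
    also have "(1 / 2 :: real) ^ Suc n = 2 powr (- real (Suc n))"
      by (simp only: powr_minus powr_realpow zero_less_numeral power_one_over inverse_eq_divide)
    also have "\<dots> powr (- (10 / 3)) = a n"
    proof -
      have "- real (Suc n) * - (10 / 3) = 10 / 3 * (real n + 1)"
        by (simp add: field_simps)
      then show ?thesis
        by (simp only: a_def powr_powr)
    qed
    \<comment> \<open>A single term of the series already dominates the integrand at
      \<open>z\<close>.\<close>
    finally have "ennreal (cmod (?f z) powr (5 / 3)) * indicator ?H z \<le> (\<Sum>i\<in>{n}. ennreal (a i) * indicator (B i) z)"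
      using True \<open>z \<in> B n\<close> by (simp add: ennreal_leI)
    also have "\<dots> \<le> (\<Sum>n. ennreal (a n) * indicator (B n) z)"
      by (intro sum_le_suminf) auto
    finally show ?thesis .
  qed auto
  have vol: "ennreal (a n) * emeasure lborel (B n) = ennreal (c * (2 powr (- (2 / 3))) ^ n)" for n
  proof -
    have "a n = 2 powr (10 / 3) * 2 powr (10 / 3 * real n)"
      by (simp add: a_def distrib_left add.commute flip: powr_add)
    also have "2 powr (10 / 3 * real n) = (2 powr (10 / 3)) ^ n"
      by (simp add: powr_powr flip: powr_realpow)
    finally have a_eq: "a n = 2 powr (10 / 3) * (2 powr (10 / 3)) ^ n" .
    have "((1 / 2) ^ n) ^ 4 = ((1 / 2 :: real) ^ 4) ^ n"
      by (metis power_mult mult.commute)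
    then have "(2 * (1 / 2 :: real) ^ n) ^ 4 = 16 * (1 / 16) ^ n"
      by (simp only: power_mult_distrib) (simp add: power4_eq_xxxx)
    then have "a n * (unit_ball_vol 4 * (2 * (1 / 2) ^ n) ^ 4) = c * (2 powr (10 / 3) * (1 / 16)) ^ n"
      unfolding a_eq c_def power_mult_distrib [of "2 powr (10 / 3)"] by simp
    also have "2 powr (10 / 3) * (1 / 16) = (2 powr (10 / 3) * 2 powr (- 4) :: real)"
      by (simp add: powr_minus)
    also have "\<dots> = 2 powr (- (2 / 3))"
      by (simp flip: powr_add)
    finally show ?thesis
      by (simp add: B_def emeasure_ball a_def flip: ennreal_mult)
  qed
  have "(\<integral>\<^sup>+z. ennreal (cmod (?f z) powr (5 / 3)) * indicator ?H z \<partial>lborel)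
      \<le> (\<integral>\<^sup>+z. (\<Sum>n. ennreal (a n) * indicator (B n) z) \<partial>lborel)"
    by (intro nn_integral_mono le)
  also have "\<dots> = (\<Sum>n. \<integral>\<^sup>+z. ennreal (a n) * indicator (B n) z \<partial>lborel)"
    by (intro nn_integral_suminf) (auto simp: B_def intro!: borel_measurable_times_ennreal borel_measurable_indicator)
  also have "\<dots> = (\<Sum>n. ennreal (c * (2 powr (- (2 / 3))) ^ n))"
    by (subst nn_integral_cmult_indicator) (auto simp: B_def vol [unfolded B_def])
  also have "\<dots> < \<infinity>"
  proof -
    have "2 powr (- (2 / 3)) < (2::real) powr 0"
      by (intro powr_less_mono) auto
    then have "summable (\<lambda>n. c * (2 powr (- (2 / 3)) :: real) ^ n)"
      by (intro summable_mult summable_geometric) auto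
    then show ?thesis
      by (subst suminf_ennreal2) (auto simp: c_def)
  qed
  finally have fin: "(\<integral>\<^sup>+z. ennreal (cmod (?f z) powr (5 / 3)) * indicator ?H z \<partial>lborel) < \<infinity>" .
  have "(\<integral>\<^sup>+z. ennreal (norm (indicator ?H z *\<^sub>R (cmod (?f z) powr (5 / 3)))) \<partial>lborel)
      = (\<integral>\<^sup>+z. ennreal (cmod (?f z) powr (5 / 3)) * indicator ?H z \<partial>lborel)"
    by (intro nn_integral_cong) (auto simp: indicator_def)
  then have "set_integrable lborel ?H (\<lambda>z. cmod (?f z) powr (5 / 3))"
    unfolding set_integrable_def
    using fin set_borel_measurable_cmod_powr [OF hol open_hartogs_triangle, of "5 / 3"]
    by (intro integrableI_bounded) (auto simp: set_borel_measurable_def)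
  then show ?thesis
    using hol by (simp add: bergman_space_def)
qed

section \<open>Positive distance from the square-integrable functions\<close>

lemma nn_integral_bergman_space:
  assumes "f \<in> bergman_space p U"
  shows "(\<integral>\<^sup>+z. ennreal (cmod (f z) powr p) * indicator U z \<partial>lborel) = ennreal (LINT z:U|lborel. cmod (f z) powr p)"
proof -
  have "(\<integral>\<^sup>+z. ennreal (indicator U z *\<^sub>R cmod (f z) powr p) \<partial>lborel) = ennreal (LINT z:U|lborel. cmod (f z) powr p)"
    unfolding set_lebesgue_integral_def
    using assms by (intro nn_integral_eq_integral) (auto simp: bergman_space_def set_integrable_def)
  moreover have "(\<integral>\<^sup>+z. ennreal (indicator U z *\<^sub>R cmod (f z) powr p) \<partial>lborel) = (\<integral>\<^sup>+z. ennreal (cmod (f z) powr p) * indicator U z \<partial>lborel)"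
    by (intro nn_integral_cong) (auto simp: indicator_def)
  ultimately show ?thesis
    by simp
qed

theorem proposition1p7:
  "\<not> dense_in_bergman (bergman_space 2 hartogs_triangle) (5 / 3) hartogs_triangle"
proof
  let ?H = hartogs_triangle
  let ?f = "\<lambda>z::complex \<times> complex. 1 / snd z ^ 2"
  assume dense: "dense_in_bergman (bergman_space 2 ?H) (5 / 3) ?H"
  \<comment> \<open>On this ball \<open>cmod (fst z) < 1/8\<close> and
    \<open>5/8 < cmod (snd z) < 7/8\<close>, so it lies in the region where the average of a
    square-integrable function vanishes almost everywhere.\<close>
  define D where "D = ball (0::complex, 3 / 4 :: complex) (1 / 8)"
  have D: "z \<in> ?H" "1 / 2 \<le> cmod (snd z)" if "z \<in> D" for z
  proof -
    have "dist (fst z) 0 < 1 / 8" "dist (snd z) (3 / 4) < 1 / 8"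
      using that dist_fst_le [of z "(0, 3 / 4)"] dist_snd_le [of z "(0, 3 / 4)"]
      by (auto simp: D_def dist_commute)
    then show "z \<in> ?H" "1 / 2 \<le> cmod (snd z)"
      using norm_triangle_ineq2 [of "3 / 4" "3 / 4 - snd z"] norm_triangle_ineq2 [of "snd z" "3 / 4"]
      by (auto simp: hartogs_triangle_def dist_norm norm_minus_commute split: prod.splits)
  qed
  define v where "v = measure lborel D"
  have v: "0 < v"
    by (simp add: v_def D_def)
  have "emeasure lborel D < \<infinity>"
    unfolding D_def by (intro emeasure_bounded_finite bounded_ball)
  then have vD: "emeasure lborel D = ennreal v"
    unfolding v_def by (intro emeasure_eq_ennreal_measure) auto
  \<comment> \<open>The tolerance is the norm that a function of modulus one on \<open>D\<close> and
    zero elsewhere would have; the contradiction is that the projected error is at least that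
    large.\<close>
  obtain g where g: "g \<in> bergman_space 2 ?H"
    and lt: "bergman_norm (5 / 3) ?H (\<lambda>z. ?f z - g z) < v powr (1 / (5 / 3))"
  proof -
    have "0 < v powr (1 / (5 / 3))"
      using v by simp
    from dense [unfolded dense_in_bergman_def, rule_format, OF inverse_square_in_bergman_space this]
    show ?thesis
      using that by (elim bexE)
  qed
  define h where "h z = ?f z - g z" for z
  have g': "g \<in> bergman_space (5 / 3) ?H"
    using g bergman_space_mono [OF open_hartogs_triangle bounded_hartogs_triangle, of "5 / 3" 2] by auto
  have h: "h \<in> bergman_space (5 / 3) ?H"
    unfolding h_def by (intro bergman_space_diff open_hartogs_triangle inverse_square_in_bergman_space g') auto
  have cont: "continuous_on ?H ?f" "continuous_on ?H g" "continuous_on ?H h"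
    using inverse_square_in_bergman_space g h
    by (auto simp: bergman_space_def intro: holomorphic2_on_imp_continuous_on)
  have "AE z in lborel. z \<in> ?H \<longrightarrow> 1 / 2 \<le> cmod (snd z) \<longrightarrow> circle_avg g z = 0"
    using g nn_integral_bergman_space [OF g] by (intro circle_avg_eq_0_AE) (simp_all add: bergman_space_def del: powr_numeral)
  \<comment> \<open>Almost everywhere on \<open>D\<close> the average of \<open>h\<close> is
    \<open>?f z - 0\<close>, and \<open>cmod (?f z) \<ge> 1\<close> because
    \<open>cmod (snd z) < 1\<close>.\<close>
  then have "AE z in lborel. indicator D z \<le> ennreal (cmod (circle_avg h z) powr (5 / 3)) * indicator ?H z"
  proof eventually_elim
    case (elim z)
    show ?case
    proof (cases "z \<in> D")
      case True
      then have z: "z \<in> ?H" "1 / 2 \<le> cmod (snd z)"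
        by (rule D)+
      have "circle_avg h z = ?f z"
        unfolding h_def using elim z
        by (subst circle_avg_diff [OF cont(1,2)]) (auto simp: circle_avg_inverse_square hartogs_triangle_rotate)
      moreover have "cmod (snd z) ^ 2 \<le> 1" "cmod (snd z) \<noteq> 0"
        using z by (auto simp: hartogs_triangle_def power_le_one)
      ultimately have "1 \<le> cmod (circle_avg h z)"
        by (simp add: norm_divide norm_power)
      then have "1 \<le> cmod (circle_avg h z) powr (5 / 3)"
        by (intro ge_one_powr_ge_zero) auto
      then show ?thesis
        using z True by simp
    qed auto
  qed
  then have "(\<integral>\<^sup>+z. indicator D z \<partial>lborel) \<le> (\<integral>\<^sup>+z. ennreal (cmod (circle_avg h z) powr (5 / 3)) * indicator ?H z \<partial>lborel)"
    by (rule nn_integral_mono_AE)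
  also have "\<dots> \<le> (\<integral>\<^sup>+z. ennreal (cmod (h z) powr (5 / 3)) * indicator ?H z \<partial>lborel)"
    by (intro nn_integral_circle_avg_le open_hartogs_triangle hartogs_triangle_rotate cont) auto
  also have "\<dots> = ennreal (LINT z:?H|lborel. cmod (h z) powr (5 / 3))"
    using h by (rule nn_integral_bergman_space)
  finally have "ennreal v \<le> ennreal (LINT z:?H|lborel. cmod (h z) powr (5 / 3))"
    by (simp add: D_def vD [unfolded D_def])
  then have "v \<le> (LINT z:?H|lborel. cmod (h z) powr (5 / 3))"
    using v by (smt (verit) ennreal_le_iff2)
  then have "v powr (1 / (5 / 3)) \<le> bergman_norm (5 / 3) ?H h"
    unfolding bergman_norm_def using v by (intro powr_mono2) auto
  with lt show False
    by (simp add: h_def [abs_def])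
qed

end
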